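(* Let $1<\kappa_1<\kappa_2$ be integers. Then there is a constant $c_{\kappa_1,\kappa_2}>0$, depending only on $\kappa_1,\kappa_2$, such that for all sufficiently large $x$ there exist sets of positive integers $A,B,C\subseteq\{1,2,\dots,x\}$ with $$|A|=\kappa_1,\quad |B|=\kappa_2,\quad |C|\geq |B|\geq |A|,$$ such that every element of $A+B+C$ is prime and $$|A+B+C|\ >\ c_{\kappa_1,\kappa_2}\,\frac{x}{\log^{\kappa_1\kappa_2}x}.$$
   Context: For sets $A,B,C$ of integers, $A+B+C=\{a+b+c: a\in A,b\in B,c\in C\}$ and $|S|$ denotes the number of elements of a finite set $S$. *)

theory Defs
  imports Complex_Main "HOL-Library.Set_Algebras" "HOL-Computational_Algebra.Primes"
begin

end

theory Submission
  imports Defs "HOL-Real_Asymp.Real_Asymp"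
begin

text \<open>
  Let \<open>N = \<lfloor>\<surd>x\<rfloor>\<close>. By Chebyshev's bound the proportion of triples \<open>(a, b, c)\<close> with
  \<open>a, b \<le> N\<close>, \<open>c \<le> x\<close> and \<open>a + b + c\<close> prime is at least \<open>\<delta> = 1 / (8 ln x)\<close>. By convexity, a bipartite
  graph of density \<open>D\<close> has \<open>k\<close> vertices on one side whose common neighbourhood has density of order
  \<open>D^k\<close>. Applied to pairs \<open>(c, b)\<close> against \<open>a\<close> this yields a set \<open>A\<close> such that
  \<open>A + b + c\<close> consists of primes for a proportion of order \<open>\<delta>^\<kappa>\<^sub>1\<close> of the pairs \<open>(b, c)\<close>; applied to these
  pairs it yields \<open>B\<close> and a set \<open>C\<close> of density of order \<open>\<delta>^(\<kappa>\<^sub>1 \<kappa>\<^sub>2)\<close>.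
  Since \<open>N\<close> exceeds every power of \<open>ln x\<close>, there is room for \<open>\<kappa>\<^sub>1\<close> and \<open>\<kappa>\<^sub>2\<close>
  distinct elements.
\<close>

section \<open>Chebyshev's lower bound through Leibniz's triangle\<close>

text \<open>With \<open>L(n, k) = (n + 1) (n choose k)\<close>, the induction step is
  \<open>M / L(n + 1, k + 1) = M / L(n, k) - M / L(n + 1, k)\<close>.\<close>

lemma Leibniz_triangle_dvd:
  fixes M :: nat
  assumes "k \<le> n" "\<And>j. j \<in> {1..n+1} \<Longrightarrow> j dvd M"
  shows "(n + 1) * (n choose k) dvd M"
  using assms
proof (induction k arbitrary: n)
  case 0
  then show ?case by simp
next
  case (Suc k)
  then obtain m where n: "n = Suc m" and km: "k \<le> m"
    by (cases n) auto
  \<comment> \<open>Here \<open>s\<close> is M / L(m, k) and \<open>t\<close> is M / L(m + 1, k), so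
    the cofactor wanted for L(m + 1, k + 1) is \<open>s - t\<close>. The argument moves to
    \<open>int\<close> so that this subtraction is not truncated.\<close>
  obtain s where s: "M = (m + 1) * (m choose k) * s"
    using Suc.IH[of m] Suc.prems km n by auto
  obtain t where t: "M = (m + 2) * (Suc m choose k) * t"
    using Suc.IH[of "Suc m"] Suc.prems km n by auto
  define a where "a = int (m choose k)"
  define b where "b = int (Suc m choose Suc k)"
  define d where "d = int (Suc m choose k)"
  have "Suc k * (Suc m choose Suc k) = Suc m * (m choose k)"
    using Suc_times_binomial_eq[of m k] by (simp only: mult.commute)
  then have 1: "(int k + 1) * b = (int m + 1) * a"
    unfolding a_def b_def by (metis of_nat_mult of_nat_Suc add.commute)
  have "(Suc m - k) * (Suc m choose k) = Suc m * (m choose k)"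
    using binomial_absorb_comp[of "Suc m" k] by simp
  then have 2: "(int m + 1 - int k) * d = (int m + 1) * a"
    unfolding a_def d_def using km
    by (metis of_nat_mult of_nat_Suc add.commute of_nat_diff le_Suc_eq)
  have 3: "int M = (int m + 1) * a * int s" "int M = (int m + 2) * d * int t"
    unfolding a_def d_def by (subst s t, simp add: algebra_simps)+
  \<comment> \<open>After multiplication by \<open>a\<close>, identity 2 makes both terms multiples
    of \<open>b * M\<close>, with coefficients m + 2 and m + 1 - k. Their difference is k + 1, and
    identity 1 turns (k + 1) b into (m + 1) a, after which \<open>a\<close> cancels.\<close>
  have "int M * (int m + 1) = (int m + 1) * ((int m + 2) * b * (int s - int t))"
  proof -
    have pos: "a > 0" unfolding a_def using km by simp
    have "(int m + 1) * a * ((int m + 2) * b * (int s - int t)) =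
        (int m + 2) * b * (int M) - (int m + 1) * a * (int m + 2) * b * int t"
      using 3(1) by (simp add: algebra_simps)
    also have "(int m + 1) * a * (int m + 2) * b * int t = (int m + 1 - int k) * b * int M"
      unfolding 2[symmetric] 3(2) by (simp only: mult_ac)
    also have "(int m + 2) * b * int M - (int m + 1 - int k) * b * int M = (int k + 1) * b * int M"
      by (simp add: algebra_simps)
    also have "\<dots> = (int m + 1) * a * int M" using 1 by simp
    finally show ?thesis using pos by simp
  qed
  then have "int M = (int m + 2) * b * (int s - int t)"
    by (metis mult.commute mult_cancel_left of_nat_Suc add.commute of_nat_eq_0_iff nat.distinct(1))
  then have "int ((m + 2) * (Suc m choose Suc k)) dvd int M"
    unfolding b_def by (metis dvd_triv_left of_nat_add of_nat_mult of_nat_numeral)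
  then show ?case unfolding n int_dvd_int_iff by simp
qed

text \<open>The number \<open>M\<close> is lcm(1, ..., 2m + 1), written as a product of one maximal
  prime power for each prime up to n = 2m + 1. Each such power is at most n, which bounds
  \<open>M\<close> above; the middle entry (2m + 1) (2m choose m) of Leibniz's triangle divides
  \<open>M\<close> and is at least 4^m.\<close>

lemma four_power_le_primes:
  assumes "m \<ge> 1"
  shows "4 ^ m \<le> (2 * m + 1) ^ card {p. prime p \<and> p \<le> 2 * m + 1}"
proof -
  define n where "n = 2 * m + 1"
  define P where "P = {p. prime p \<and> p \<le> n}"
  define e where "e p = nat \<lfloor>log (real p) (real n)\<rfloor>" for p
  define M where "M = (\<Prod>p\<in>P. p ^ e p)"
  have finP: "finite P" unfolding P_def by simp
  have e_iff: "p ^ i \<le> n \<longleftrightarrow> i \<le> e p" if "p \<in> P" for p i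
  proof -
    have p: "real p > 1" using that prime_gt_1_nat unfolding P_def by auto
    have "p ^ i \<le> n \<longleftrightarrow> real p ^ i \<le> real n"
      by (metis of_nat_le_iff of_nat_power)
    also have "\<dots> \<longleftrightarrow> real i \<le> log (real p) (real n)"
      using p by (subst le_log_iff) (auto simp: n_def powr_realpow)
    also have "\<dots> \<longleftrightarrow> i \<le> e p"
    proof
      assume "i \<le> e p"
      then have "real i \<le> real (e p)" by simp
      also have "\<dots> \<le> log (real p) (real n)"
        unfolding e_def using p by (intro of_nat_floor) (simp add: n_def)
      finally show "real i \<le> log (real p) (real n)" .
    qed (auto simp: e_def intro: le_nat_floor)
    finally show ?thesis .
  qed
  have "j dvd M" if j: "j \<in> {1..2*m+1}" for j
  proof -
    have j0: "j > 0" "j \<le> n" using j unfolding n_def by auto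
    have "j = (\<Prod>p\<in>prime_factors j. p ^ multiplicity p j)"
      using j0 prod_prime_factors[of j] by simp
    also have "\<dots> dvd M"
      unfolding M_def
    proof (rule prod_dvd_prod_subset2[OF finP])
      show sub: "prime_factors j \<subseteq> P"
        using j0 unfolding P_def by (auto dest: dvd_imp_le simp: prime_factors_dvd)
      fix p assume p: "p \<in> prime_factors j"
      have "p ^ multiplicity p j \<le> n"
        using j0 dvd_imp_le[OF multiplicity_dvd, of j p] by linarith
      then show "p ^ multiplicity p j dvd p ^ e p"
        using e_iff p sub by (intro le_imp_power_dvd) auto
    qed
    finally show ?thesis .
  qed
  then have dvd: "(2 * m + 1) * (2 * m choose m) dvd M"
    by (intro Leibniz_triangle_dvd) auto
  have "M > 0"
    unfolding M_def P_def by (auto intro!: prod_pos simp: prime_gt_0_nat)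
  have "4 ^ m / (2 * real m) \<le> real (2 * m choose m)"
    using central_binomial_lower_bound[of m] assms by simp
  then have "4 ^ m \<le> 2 * real m * real (2 * m choose m)"
    using assms by (simp add: field_simps)
  also have "\<dots> \<le> real ((2 * m + 1) * (2 * m choose m))"
    by (simp add: algebra_simps)
  finally have "4 ^ m \<le> (2 * m + 1) * (2 * m choose m)"
    by (metis of_nat_le_iff of_nat_numeral of_nat_power)
  also have "\<dots> \<le> M" using dvd \<open>M > 0\<close> by (rule dvd_imp_le)
  also have "M \<le> (\<Prod>p\<in>P. n)"
    unfolding M_def using e_iff by (intro prod_mono) auto
  also have "\<dots> = n ^ card P" by simp
  finally show ?thesis unfolding n_def P_def .
qed

lemma Chebyshev_lower_bound:
  fixes n :: nat
  assumes "n \<ge> 4"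
  shows "real n / 4 \<le> real (card {p. prime p \<and> p \<le> n}) * ln (real n)"
proof -
  define m where "m = (n - 1) div 2"
  have m: "m \<ge> 1" "2 * m + 1 \<le> n" "n \<le> 2 * m + 2" using assms unfolding m_def by auto
  have "4 ^ m \<le> (2 * m + 1) ^ card {p. prime p \<and> p \<le> 2 * m + 1}"
    using m by (intro four_power_le_primes)
  also have "\<dots> \<le> n ^ card {p. prime p \<and> p \<le> 2 * m + 1}"
    using m by (intro power_mono) auto
  also have "\<dots> \<le> n ^ card {p. prime p \<and> p \<le> n}"
    using m by (intro power_increasing card_mono) auto
  finally have "(4::real) ^ m \<le> real n ^ card {p. prime p \<and> p \<le> n}"
    by (metis of_nat_le_iff of_nat_numeral of_nat_power)
  then have "ln ((4::real) ^ m) \<le> ln (real n ^ card {p. prime p \<and> p \<le> n})"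
    using assms by (subst ln_le_cancel_iff) auto
  then have "real m * ln 4 \<le> real (card {p. prime p \<and> p \<le> n}) * ln (real n)"
    using assms by (simp add: ln_realpow)
  \<comment> \<open>The crude bound ln 4 >= 1 is enough, as m >= (n - 2) / 2 >= n / 4 for n >=
    4.\<close>
  moreover have "ln (4::real) \<ge> 1"
    using exp_le by (subst ln_ge_iff) auto
  then have "real m * 1 \<le> real m * ln 4" by (intro mult_left_mono) auto
  ultimately show ?thesis using m by linarith
qed

section \<open>Common neighbourhoods in dense bipartite graphs\<close>

text \<open>The number of pairs of a vertex in \<open>U\<close> and a \<open>k\<close>-subset of its neighbourhood is bounded
  below by convexity; averaging over the at most \<open>|V|^k\<close> subsets gives the claim.\<close>

lemma exists_common_neighbours:
  fixes R :: "'a \<Rightarrow> 'b \<Rightarrow> bool" and D :: real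
  assumes fin: "finite U" "finite V" and ne: "U \<noteq> {}" "V \<noteq> {}" and "k \<ge> 1" "D > 0"
    and density: "D * card U * card V \<le> (\<Sum>u\<in>U. real (card {v \<in> V. R u v}))"
    and large: "2 \<le> D * card V / k"
  obtains A where "A \<subseteq> V" "card A = k"
    "card U * (D / k) ^ k / 2 \<le> real (card {u \<in> U. \<forall>a\<in>A. R u a})"
proof -
  define S where "S = {A. A \<subseteq> V \<and> card A = k}"
  define d where "d u = card {v \<in> V. R u v}" for u
  \<comment> \<open>By \<open>density\<close> the average of \<open>d\<close> over \<open>U\<close>
    is at least D |V| = k m, so \<open>m\<close> is the lower bound for the mean degree, scaled by 1
    / k.\<close>
  define m where "m = D * card V / k"
  have finS: "finite S" unfolding S_def using fin by simp
  have cV: "card V > 0" and cU: "card U > 0" using fin ne by (auto simp: card_gt_0_iff)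
  have m: "m \<ge> 2" "m > 0" using large unfolding m_def by auto
  have "m ^ 1 \<le> m ^ k" using m \<open>k \<ge> 1\<close> by (intro power_increasing) auto
  then have mk: "m ^ k \<ge> 2" using m by simp
  have swap: "(\<Sum>A\<in>S. real (card {u \<in> U. \<forall>a\<in>A. R u a})) = (\<Sum>u\<in>U. real (d u choose k))"
  proof -
    have "(\<Sum>A\<in>S. real (card {u \<in> U. \<forall>a\<in>A. R u a})) =
        (\<Sum>A\<in>S. \<Sum>u\<in>U. if \<forall>a\<in>A. R u a then 1 else 0)"
      using fin by (simp add: sum.If_cases Int_def)
    also have "\<dots> = (\<Sum>u\<in>U. \<Sum>A\<in>S. if \<forall>a\<in>A. R u a then 1 else 0)"
      by (rule sum.swap)
    also have "\<dots> = (\<Sum>u\<in>U. real (card {A. A \<subseteq> {v \<in> V. R u v} \<and> card A = k}))"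
      using finS by (intro sum.cong) (auto simp: sum.If_cases Int_def S_def intro!: arg_cong[where f = card])
    also have "\<dots> = (\<Sum>u\<in>U. real (d u choose k))"
      using fin by (simp add: n_subsets d_def)
    finally show ?thesis .
  qed
  \<comment> \<open>Bernoulli's inequality gives the tangent line of (t / k)^k at t = k m. The loss
    of 1 covers degrees below k, where the binomial coefficient vanishes but (t / k)^k may still be
    as large as almost 1.\<close>
  have tangent: "m ^ k * (1 + real k * (d u / (k * m) - 1)) - 1 \<le> real (d u choose k)" for u
  proof -
    have "1 + real k * (d u / (k * m) - 1) \<le> (1 + (d u / (k * m) - 1)) ^ k"
      using m by (intro Bernoulli_inequality) auto
    then have "m ^ k * (1 + real k * (d u / (k * m) - 1)) \<le> m ^ k * (d u / (k * m)) ^ k"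
      using m by (intro mult_left_mono) auto
    also have "\<dots> = (d u / k) ^ k"
      using m by (simp flip: power_mult_distrib)
    also have "\<dots> \<le> real (d u choose k) + 1"
    proof (cases "k \<le> d u")
      case True
      then show ?thesis using binomial_ge_n_over_k_pow_k[of k "d u", where 'a = real] by simp
    next
      case False
      then have "(d u / k) ^ k \<le> 1 ^ k" by (intro power_mono) auto
      then show ?thesis by simp
    qed
    finally show ?thesis by simp
  qed
  have km: "k * m = D * card V" unfolding m_def using \<open>k \<ge> 1\<close> by simp
  \<comment> \<open>Since m^k >= 2, the loss of 1 per vertex costs at most half of the main term.
    The linear term of the tangent is nonnegative after summation, because the mean degree is at
    least k m.\<close>
  have "card U * m ^ k / 2 \<le> card U * (m ^ k - 1)"
    using mk cU by (simp add: field_simps)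
  also have "\<dots> \<le> m ^ k * (card U + real k * ((\<Sum>u\<in>U. real (d u)) / (k * m) - card U)) - card U"
  proof -
    have "0 \<le> (\<Sum>u\<in>U. real (d u)) / (k * m) - card U"
      using density \<open>D > 0\<close> cV unfolding km d_def by (simp add: field_simps)
    then have "0 \<le> m ^ k * (real k * ((\<Sum>u\<in>U. real (d u)) / (k * m) - card U))"
      using m by simp
    then show ?thesis by (simp only: distrib_left right_diff_distrib) (simp add: mult.commute)
  qed
  also have "\<dots> = (\<Sum>u\<in>U. m ^ k * (1 + real k * (d u / (k * m) - 1)) - 1)"
    by (simp add: sum_subtractf sum.distrib sum_distrib_left[symmetric] sum_divide_distrib[symmetric])
  also have "\<dots> \<le> (\<Sum>A\<in>S. real (card {u \<in> U. \<forall>a\<in>A. R u a}))"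
    unfolding swap by (intro sum_mono tangent)
  finally have lower: "card U * m ^ k / 2 \<le> (\<Sum>A\<in>S. real (card {u \<in> U. \<forall>a\<in>A. R u a}))" .
  have "\<exists>A\<in>S. card U * (D / k) ^ k / 2 \<le> real (card {u \<in> U. \<forall>a\<in>A. R u a})"
  proof (rule ccontr)
    assume "\<not> ?thesis"
    then have less: "real (card {u \<in> U. \<forall>a\<in>A. R u a}) < card U * (D / k) ^ k / 2" if "A \<in> S" for A
      using that by (auto simp: not_le)
    \<comment> \<open>The strict sum comparison needs a nonempty index set; an empty
      \<open>S\<close> would make the sum in \<open>lower\<close> zero.\<close>
    have "S \<noteq> {}"
      using lower mk cU by (auto simp: not_le mult_le_0_iff)
    then have "(\<Sum>A\<in>S. real (card {u \<in> U. \<forall>a\<in>A. R u a})) < (\<Sum>A\<in>S. card U * (D / k) ^ k / 2)"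
      using finS less by (intro sum_strict_mono) auto
    also have "\<dots> = real (card V choose k) * (card U * (D / k) ^ k / 2)"
      unfolding S_def using fin by (simp add: n_subsets)
    \<comment> \<open>The crude count |V|^k of subsets fits exactly: |V|^k (D / k)^k = m^k.\<close>
    also have "\<dots> \<le> real (card V ^ k) * (card U * (D / k) ^ k / 2)"
    proof (rule mult_right_mono)
      show "real (card V choose k) \<le> real (card V ^ k)"
        by (cases "k \<le> card V") (auto simp: binomial_le_pow binomial_eq_0 simp del: of_nat_power)
    qed (use \<open>D > 0\<close> in simp)
    also have "\<dots> = card U * m ^ k / 2"
      unfolding m_def by (simp add: power_mult_distrib power_divide)
    finally show False using lower by simp
  qed
  then show ?thesis using that unfolding S_def by blast
qed

section \<open>From the density of primes to the sets A, B, C\<close>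

lemma card_le_card_set_plus:
  fixes C :: "nat set"
  assumes "finite S" "finite C" "S \<noteq> {}"
  shows "card C \<le> card (S + C)"
proof -
  obtain s where s: "s \<in> S" using assms by auto
  have "card C = card ((+) s ` C)" by (simp add: card_image)
  also have "\<dots> \<le> card (S + C)"
    using assms s by (intro card_mono) (auto intro: finite_set_plus)
  finally show ?thesis .
qed

text \<open>Only primes above 2N are counted, so that p - a - b is positive for all a, b <= N and
  every pair (a, b) has many admissible c. The conditions \<open>large1\<close> and
  \<open>large2\<close> are the size requirements of the two applications of
  \<open>exists_common_neighbours\<close>.\<close>

lemma prime_sum_sets:
  fixes x N k l :: nat and \<delta> :: real
  assumes "x \<ge> 1" "N \<ge> 1" "k \<ge> 1" "l \<ge> 1" "\<delta> > 0"
    and primes: "\<delta> * x \<le> card {p. prime p \<and> 2 * N < p \<and> p \<le> x}"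
    and large1: "2 \<le> \<delta> * N / k"
    and large2: "2 \<le> ((\<delta> / k) ^ k / 2) * N / l"
  obtains A B C where "A \<subseteq> {1..N}" "B \<subseteq> {1..N}" "C \<subseteq> {1..x}" "card A = k" "card B = l"
    "\<forall>p \<in> A + B + C. prime p" "x * (((\<delta> / k) ^ k / 2) / l) ^ l / 2 \<le> card C"
proof -
  have fibre: "\<delta> * x \<le> card {c \<in> {1..x}. prime (c + a + b)}"
    if "a \<in> {1..N}" "b \<in> {1..N}" for a b
  proof -
    \<comment> \<open>Translation by a + b <= 2N < p stays injective under truncated subtraction and
      lands in {1..x}.\<close>
    have "card {p. prime p \<and> 2 * N < p \<and> p \<le> x} \<le> card {c \<in> {1..x}. prime (c + a + b)}"
    proof (rule card_inj_on_le)
      show "inj_on (\<lambda>p. p - (a + b)) {p. prime p \<and> 2 * N < p \<and> p \<le> x}"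
        using that by (auto simp: inj_on_def)
      show "(\<lambda>p. p - (a + b)) ` {p. prime p \<and> 2 * N < p \<and> p \<le> x} \<subseteq> {c \<in> {1..x}. prime (c + a + b)}"
        using that by (auto simp: add.assoc)
    qed auto
    then show ?thesis using primes by linarith
  qed
  let ?U = "{1..x} \<times> {1..N}"
  let ?D = "(\<delta> / k) ^ k / 2"
  have "(\<Sum>u\<in>?U. real (card {a \<in> {1..N}. prime (fst u + a + snd u)})) =
      (\<Sum>u\<in>?U. \<Sum>a\<in>{1..N}. if prime (fst u + a + snd u) then 1 else 0)"
    by (simp add: sum.If_cases Int_def)
  also have "\<dots> = (\<Sum>a\<in>{1..N}. \<Sum>u\<in>?U. if prime (fst u + a + snd u) then 1 else 0)"
    by (rule sum.swap)
  also have "\<dots> = (\<Sum>a\<in>{1..N}. \<Sum>b\<in>{1..N}. \<Sum>c\<in>{1..x}. if prime (c + a + b) then 1 else 0)"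
    by (subst sum.swap[of _ "{1..x}" "{1..N}"]) (simp add: sum.cartesian_product split_beta)
  also have "\<dots> = (\<Sum>a\<in>{1..N}. \<Sum>b\<in>{1..N}. real (card {c \<in> {1..x}. prime (c + a + b)}))"
    by (simp add: sum.If_cases Int_def)
  also have "\<dots> \<ge> (\<Sum>a\<in>{1..N}. \<Sum>b\<in>{1..N}. \<delta> * x)"
    by (intro sum_mono fibre)
  finally have "\<delta> * card ?U * card {1..N} \<le>
      (\<Sum>u\<in>?U. real (card {a \<in> {1..N}. prime (fst u + a + snd u)}))"
    by (simp add: mult_ac)
  then obtain A where A: "A \<subseteq> {1..N}" "card A = k"
    "card ?U * (\<delta> / k) ^ k / 2 \<le> real (card {u \<in> ?U. \<forall>a\<in>A. prime (fst u + a + snd u)})"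
    using assms exists_common_neighbours[of ?U "{1..N}" k \<delta> "\<lambda>u a. prime (fst u + a + snd u)"]
    by auto
  \<comment> \<open>Slicing the surviving pairs by c turns them into the edges of a new bipartite
    graph between c and b, whose density is at least \<open>?D\<close>.\<close>
  have "{u \<in> ?U. \<forall>a\<in>A. prime (fst u + a + snd u)} =
      (SIGMA c:{1..x}. {b \<in> {1..N}. \<forall>a\<in>A. prime (c + a + b)})"
    by auto
  then have "real (card {u \<in> ?U. \<forall>a\<in>A. prime (fst u + a + snd u)}) =
      (\<Sum>c\<in>{1..x}. real (card {b \<in> {1..N}. \<forall>a\<in>A. prime (c + a + b)}))"
    by simp
  then have "?D * card {1..x} * card {1..N} \<le>
      (\<Sum>c\<in>{1..x}. real (card {b \<in> {1..N}. \<forall>a\<in>A. prime (c + a + b)}))"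
    using A(3) by (simp add: mult_ac)
  then obtain B where B: "B \<subseteq> {1..N}" "card B = l"
    "card {1..x} * (?D / l) ^ l / 2 \<le> real (card {c \<in> {1..x}. \<forall>b\<in>B. \<forall>a\<in>A. prime (c + a + b)})"
    using assms exists_common_neighbours[of "{1..x}" "{1..N}" l ?D "\<lambda>c b. \<forall>a\<in>A. prime (c + a + b)"]
    by auto
  show ?thesis
  proof (rule that[OF A(1) B(1) _ A(2) B(2)])
    show "\<forall>p\<in>A + B + {c \<in> {1..x}. \<forall>b\<in>B. \<forall>a\<in>A. prime (c + a + b)}. prime p"
    proof
      fix p assume "p \<in> A + B + {c \<in> {1..x}. \<forall>b\<in>B. \<forall>a\<in>A. prime (c + a + b)}"
      then obtain a b c where "p = a + b + c" "prime (c + a + b)"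
        by (auto elim!: set_plus_elim)
      then show "prime p" by (simp add: add_ac)
    qed
  qed (use B(3) in auto)
qed

text \<open>Chebyshev's bound supplies x / (4 ln x) primes; discarding the numbers up to 2N <= 2
  sqrt x eventually costs at most half of that.\<close>

lemma card_primes_between_ge:
  "\<forall>\<^sub>F x :: nat in at_top.
     1 / (8 * ln x) * x \<le> card {p. prime p \<and> 2 * nat \<lfloor>sqrt x\<rfloor> < p \<and> p \<le> x}"
proof -
  have "\<forall>\<^sub>F x :: nat in at_top. real x / (8 * ln x) + 2 * sqrt x \<le> real x / (4 * ln x)"
    by real_asymp
  then show ?thesis
    using eventually_ge_at_top[of 4]
  proof eventually_elim
    case (elim x)
    define N where "N = nat \<lfloor>sqrt x\<rfloor>"
    have "{p. prime p \<and> p \<le> x} \<subseteq> {p. prime p \<and> 2 * N < p \<and> p \<le> x} \<union> {1..2 * N}"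
      using prime_ge_1_nat by auto
    then have "card {p. prime p \<and> p \<le> x} \<le> card ({p. prime p \<and> 2 * N < p \<and> p \<le> x} \<union> {1..2 * N})"
      by (intro card_mono) auto
    also have "\<dots> \<le> card {p. prime p \<and> 2 * N < p \<and> p \<le> x} + card {1..2 * N}"
      by (rule card_Un_le)
    finally have "real (card {p. prime p \<and> p \<le> x}) \<le> card {p. prime p \<and> 2 * N < p \<and> p \<le> x} + 2 * real N"
      by simp
    moreover have "real N \<le> sqrt x" unfolding N_def by simp
    moreover have "real x / (4 * ln x) \<le> real (card {p. prime p \<and> p \<le> x})"
      using Chebyshev_lower_bound[of x] elim by (simp add: field_simps)
    ultimately show ?case using elim(1) unfolding N_def[symmetric] by simp
  qed
qed

theorem theorem2:
  fixes \<kappa>\<^sub>1 \<kappa>\<^sub>2 :: nat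
  assumes "1 < \<kappa>\<^sub>1" and "\<kappa>\<^sub>1 < \<kappa>\<^sub>2"
  shows "\<exists>c::real. c > 0 \<and>
    (\<forall>\<^sub>F x :: nat in at_top.
      \<exists>A B C :: nat set.
        A \<subseteq> {1..x} \<and> B \<subseteq> {1..x} \<and> C \<subseteq> {1..x} \<and>
        card A = \<kappa>\<^sub>1 \<and> card B = \<kappa>\<^sub>2 \<and> card C \<ge> card B \<and> card B \<ge> card A \<and>
        (\<forall>p \<in> A + B + C. prime p) \<and>
        real (card (A + B + C)) > c * (real x / ln (real x) ^ (\<kappa>\<^sub>1 * \<kappa>\<^sub>2)))"
proof -
  define k l where "k = \<kappa>\<^sub>1" and "l = \<kappa>\<^sub>2"
  have kl: "k \<ge> 1" "l \<ge> 1" "k < l" using assms unfolding k_def l_def by auto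
  \<comment> \<open>With \<delta> = 1 / (8 ln x), the first density (\<delta> / k)^k / 2 equals r /
    (ln x)^k, and the resulting lower bound for |C| equals q x / (ln x)^(k l).\<close>
  define r where "r = (1 / (8 * real k)) ^ k / 2"
  define q where "q = (r / l) ^ l / 2"
  have r: "r > 0" and q: "q > 0" using kl unfolding r_def q_def by auto
  \<comment> \<open>The expression sqrt x - 1 stands in for the smaller side length N = floor (sqrt
    x), which keeps the asymptotics free of floors.\<close>
  have N1: "\<forall>\<^sub>F x :: nat in at_top. 2 \<le> 1 / (8 * ln x) * (sqrt x - 1) / real k"
    using kl by real_asymp
  have N2: "\<forall>\<^sub>F x :: nat in at_top. 2 \<le> r / ln x ^ k * (sqrt x - 1) / real l"
    using kl r by real_asymp
  have C: "\<forall>\<^sub>F x :: nat in at_top. real l \<le> q * (x / ln x ^ (k * l))"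
    using kl q by real_asymp
  \<comment> \<open>Halving \<open>q\<close> makes the final inequality strict, as |C| is only known
    to be at least q x / (ln x)^(k l).\<close>
  have "\<forall>\<^sub>F x :: nat in at_top.
      \<exists>A B C :: nat set.
        A \<subseteq> {1..x} \<and> B \<subseteq> {1..x} \<and> C \<subseteq> {1..x} \<and>
        card A = k \<and> card B = l \<and> card C \<ge> card B \<and> card B \<ge> card A \<and>
        (\<forall>p \<in> A + B + C. prime p) \<and>
        real (card (A + B + C)) > q / 2 * (real x / ln (real x) ^ (k * l))"
    using N1 N2 C card_primes_between_ge eventually_ge_at_top[of 3]
  proof eventually_elim
    case (elim x)
    define N where "N = nat \<lfloor>sqrt x\<rfloor>"
    let ?\<delta> = "1 / (8 * ln x)"
    have lnx: "ln x > 0" using elim by simp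
    have N: "sqrt x - 1 \<le> real N" unfolding N_def by linarith
    have "sqrt x \<le> sqrt (x * x)"
      using elim by (intro real_sqrt_le_mono) (metis le_square of_nat_le_iff of_nat_mult)
    then have "real N \<le> x" unfolding N_def by (simp add: nat_le_iff) linarith
    then have "N \<le> x" by simp
    have "sqrt x \<ge> 1" using elim by simp
    then have "N \<ge> 1" unfolding N_def by (simp add: le_nat_iff)
    have D: "(?\<delta> / k) ^ k / 2 = r / ln x ^ k"
      unfolding r_def by (simp add: power_divide power_mult_distrib)
    have large1: "2 \<le> ?\<delta> * N / k"
    proof -
      have "?\<delta> * (sqrt x - 1) / real k \<le> ?\<delta> * N / k"
        using lnx N by (intro divide_right_mono mult_left_mono) auto
      then show ?thesis using elim by linarith
    qed
    have large2: "2 \<le> ((?\<delta> / k) ^ k / 2) * N / l"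
    proof -
      have "r / ln x ^ k * (sqrt x - 1) / l \<le> r / ln x ^ k * N / l"
        using lnx N r by (intro divide_right_mono mult_left_mono) auto
      then show ?thesis using elim unfolding D by linarith
    qed
    obtain A B C where ABC: "A \<subseteq> {1..N}" "B \<subseteq> {1..N}" "C \<subseteq> {1..x}" "card A = k" "card B = l"
      "\<forall>p \<in> A + B + C. prime p" "x * (((?\<delta> / k) ^ k / 2) / l) ^ l / 2 \<le> card C"
    proof (rule prime_sum_sets[OF _ \<open>N \<ge> 1\<close> kl(1,2) _ _ large1 large2])
      show "?\<delta> * x \<le> card {p. prime p \<and> 2 * N < p \<and> p \<le> x}"
        using elim(4) unfolding N_def .
    qed (use elim(5) lnx in auto)
    have "x * (((?\<delta> / k) ^ k / 2) / l) ^ l / 2 = q * (x / ln x ^ (k * l))"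
      unfolding D q_def by (simp add: power_divide power_mult power_mult_distrib mult_ac)
    then have cardC: "q * (x / ln x ^ (k * l)) \<le> card C" using ABC by simp
    have fin: "finite A" "finite B" "finite C" and ne: "A \<noteq> {}" "B \<noteq> {}"
      using ABC kl by (auto intro: finite_subset)
    have "card C \<le> card (A + B + C)"
      using fin ne by (intro card_le_card_set_plus finite_set_plus) (auto simp: set_plus_def)
    moreover have "q * (x / ln x ^ (k * l)) > 0" using q elim lnx by simp
    ultimately have "real (card (A + B + C)) > q / 2 * (x / ln x ^ (k * l))"
      using cardC by simp
    moreover have "card C \<ge> l" using cardC elim by linarith
    ultimately show ?case
      using ABC \<open>N \<le> x\<close> kl by (intro exI[of _ A] exI[of _ B] exI[of _ C]) auto
  qed
  then show ?thesis using q unfolding k_def l_def by (intro exI[of _ "q / 2"]) auto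
qed

end
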